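(* Every order-complete modal FL-algebra is isomorphic to the modal FL-algebra $(\mathit{Prop}(\mathcal{S}),\subseteq,\otimes,1,\Rightarrow_l,\Rightarrow_r,0,!,?)$ of all propositions of some modal FL-cover system $\mathcal{S}=(S,\preceq,\lhd,\cdot,\varepsilon,0,I,R)$ that is strong, i.e. satisfies $X\otimes Y={\uparrow}(X\cdot Y)$ for all $X,Y\in\mathit{Prop}(\mathcal{S})$. Here, for propositions $X,Y$: $X\otimes Y=j{\uparrow}(X\cdot Y)$, $1={\uparrow}\varepsilon$, $X\Rightarrow_l Y=\{z:z\cdot X\subseteq Y\}$, $X\Rightarrow_r Y=\{z:X\cdot z\subseteq Y\}$, $!X=j{\uparrow}(X\cap I)$, $?X=\{x:\exists y\,(xRy,\ y\in X)\}$, with meets being intersections and joins being $j$ of unions.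
   Context: Modal FL-algebras. A residuated lattice is $(L,\sqsubseteq,\otimes,1,\Rightarrow_l,\Rightarrow_r)$ with $(L,\sqsubseteq)$ a lattice, $(L,\otimes,1)$ a monoid with $\otimes$ monotone, and $a\sqsubseteq b\Rightarrow_l c$ iff $a\otimes b\sqsubseteq c$ iff $b\sqsubseteq a\Rightarrow_r c$. An FL-algebra is a residuated lattice with a distinguished element $0$. A modal FL-algebra is a bounded FL-algebra with unary operations $!,?$ such that for all $a,b$: (s1) $!a\sqsubseteq a$; (s2) $!a\sqsubseteq !!a$; (s3) $!1=1$; (s4) $!(a\sqcap b)=!a\otimes !b$; (s5) $!a\otimes b=b\otimes !a$; (c1) $!(a\Rightarrow_i b)\sqsubseteq ?a\Rightarrow_i ?b$ for $i=l,r$; (c2) $a\sqsubseteq ?a$; (c3) $??a\sqsubseteq ?a$; (c4) $?0\sqsubseteq 0$; (c5) $0\sqsubseteq ?a$. Order-complete means every subset has a join and meet. Cover systems. $(S,\preceq,\lhd)$: a set $S$, a preorder $\preceq$, and $\lhd\subseteq S\times\mathcal{P}(S)$. ${\uparrow}X=\{y:\exists x\in X,\ x\preceq y\}$, ${\uparrow}x={\uparrow}\{x\}$; up-sets satisfy ${\uparrow}X=X$. Cover system axioms: (Existence) each $x$ has a cover $C\subseteq{\uparrow}x$; (Transitivity) $x\lhd C$ and $y\lhd C_y$ for all $y\in C$ imply $x\lhd\bigcup_{y\in C}C_y$; (Refinement) $x\preceq y$ and $x\lhd C$ imply some $C'\subseteq{\uparrow}C$ with $y\lhd C'$. $jX=\{x:\exists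 C\,(x\lhd C\subseteq X)\}$; a proposition is an up-set $X$ with $jX\subseteq X$; $\mathit{Prop}(\mathcal{S})$ is the set of propositions. $X\cdot Y=\{x\cdot y:x\in X,y\in Y\}$, $x\cdot Y=\{x\}\cdot Y$. A residuated cover system $(S,\preceq,\lhd,\cdot,\varepsilon)$ is a cover system with an associative $\preceq$-monotone operation $\cdot$ with identity $\varepsilon$ such that $x\lhd C$ implies $x\cdot y\lhd C\cdot y$ and $y\cdot x\lhd y\cdot C$, and $x\lhd C\subseteq{\uparrow}\varepsilon$ implies $\varepsilon\preceq x$. A modal FL-cover system $(S,\preceq,\lhd,\cdot,\varepsilon,0,I,R)$ has $0\in\mathit{Prop}(\mathcal{S})$, $I\subseteq{\uparrow}\varepsilon$, $R\subseteq S\times S$, with: $(S,\preceq,\lhd,\cdot,\varepsilon)$ a residuated cover system; $I$ closed under $\cdot$ and $\varepsilon\in I$; $\varepsilon\lhd I$; each $x\in I$ has $x=x\cdot x$ and $x\cdot y=y\cdot x$ for all $y$; if $x\preceq y$ and $xRz$ then some $w$ has $z\preceq w$ and $yRw$; if some $x$-cover is included in $\langle R\rangle X=\{u:\exists v\,(uRv, v\in X)\}$ then some $y$ has $xRy$ and a $y$-cover included in $X$; $x\in I$ and $yRz$ imply $(x\cdot y)R(x\cdot z)$ and $(y\cdot x)R(z\cdot x)$; $R$ reflexive and transitive; $xRy\in 0$ implies $x\in0$; $x\in 0$ implies some $y$ with $xRy$ and $y\lhd\emptyset$. *)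

theory Defs
  imports "HOL-Algebra.Complete_Lattice" "HOL-Algebra.Coset"
begin

section \<open>Modal FL-algebras\<close>

record 'a residuated_struct = "'a gorder" +
  tensor :: "['a, 'a] \<Rightarrow> 'a" (infixl "\<odot>\<index>" 70)
  tunit :: 'a ("\<^bold>1\<index>")
  limp :: "['a, 'a] \<Rightarrow> 'a" (infixr "\<Rightarrow>\<^sub>l\<index>" 65)
  rimp :: "['a, 'a] \<Rightarrow> 'a" (infixr "\<Rightarrow>\<^sub>r\<index>" 65)

record 'a FL_struct = "'a residuated_struct" +
  fzero :: 'a ("\<^bold>0\<index>")

record 'a modal_FL_struct = "'a FL_struct" +
  bang :: "'a \<Rightarrow> 'a" ("\<^bold>!\<index>_" [81] 80)
  quest :: "'a \<Rightarrow> 'a" ("\<^bold>?\<index>_" [81] 80)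

locale residuated_lattice = lattice L
  for L :: "('a, 'b) residuated_struct_scheme" (structure) +
  assumes tensor_monoid: "monoid \<lparr>carrier = carrier L, mult = tensor L, one = \<^bold>1\<rparr>"
    and tensor_mono: "\<lbrakk>a \<in> carrier L; a' \<in> carrier L; b \<in> carrier L; b' \<in> carrier L;
        a \<sqsubseteq> a'; b \<sqsubseteq> b'\<rbrakk> \<Longrightarrow> a \<odot> b \<sqsubseteq> a' \<odot> b'"
    and limp_closed: "\<lbrakk>a \<in> carrier L; b \<in> carrier L\<rbrakk> \<Longrightarrow> a \<Rightarrow>\<^sub>l b \<in> carrier L"
    and rimp_closed: "\<lbrakk>a \<in> carrier L; b \<in> carrier L\<rbrakk> \<Longrightarrow> a \<Rightarrow>\<^sub>r b \<in> carrier L"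
    and limp_residuation: "\<lbrakk>a \<in> carrier L; b \<in> carrier L; c \<in> carrier L\<rbrakk>
        \<Longrightarrow> a \<sqsubseteq> (b \<Rightarrow>\<^sub>l c) \<longleftrightarrow> a \<odot> b \<sqsubseteq> c"
    and rimp_residuation: "\<lbrakk>a \<in> carrier L; b \<in> carrier L; c \<in> carrier L\<rbrakk>
        \<Longrightarrow> a \<odot> b \<sqsubseteq> c \<longleftrightarrow> b \<sqsubseteq> (a \<Rightarrow>\<^sub>r c)"

locale FL_algebra = residuated_lattice L
  for L :: "('a, 'b) FL_struct_scheme" (structure) +
  assumes fzero_closed: "\<^bold>0 \<in> carrier L"

locale modal_FL_algebra = FL_algebra L + bounded_lattice L
  for L :: "('a, 'b) modal_FL_struct_scheme" (structure) +
  assumes bang_closed: "a \<in> carrier L \<Longrightarrow> \<^bold>!a \<in> carrier L"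
    and quest_closed: "a \<in> carrier L \<Longrightarrow> \<^bold>?a \<in> carrier L"
    and s1: "a \<in> carrier L \<Longrightarrow> \<^bold>!a \<sqsubseteq> a"
    and s2: "a \<in> carrier L \<Longrightarrow> \<^bold>!a \<sqsubseteq> \<^bold>!(\<^bold>!a)"
    and s3: "\<^bold>!\<^bold>1 = \<^bold>1"
    and s4: "\<lbrakk>a \<in> carrier L; b \<in> carrier L\<rbrakk> \<Longrightarrow> \<^bold>!(a \<sqinter> b) = (\<^bold>!a) \<odot> (\<^bold>!b)"
    and s5: "\<lbrakk>a \<in> carrier L; b \<in> carrier L\<rbrakk> \<Longrightarrow> (\<^bold>!a) \<odot> b = b \<odot> (\<^bold>!a)"
    and c1l: "\<lbrakk>a \<in> carrier L; b \<in> carrier L\<rbrakk> \<Longrightarrow> \<^bold>!(a \<Rightarrow>\<^sub>l b) \<sqsubseteq> ((\<^bold>?a) \<Rightarrow>\<^sub>l (\<^bold>?b))"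
    and c1r: "\<lbrakk>a \<in> carrier L; b \<in> carrier L\<rbrakk> \<Longrightarrow> \<^bold>!(a \<Rightarrow>\<^sub>r b) \<sqsubseteq> ((\<^bold>?a) \<Rightarrow>\<^sub>r (\<^bold>?b))"
    and c2: "a \<in> carrier L \<Longrightarrow> a \<sqsubseteq> \<^bold>?a"
    and c3: "a \<in> carrier L \<Longrightarrow> \<^bold>?(\<^bold>?a) \<sqsubseteq> \<^bold>?a"
    and c4: "\<^bold>?\<^bold>0 \<sqsubseteq> \<^bold>0"
    and c5: "a \<in> carrier L \<Longrightarrow> \<^bold>0 \<sqsubseteq> \<^bold>?a"

locale order_complete_modal_FL_algebra = modal_FL_algebra L + complete_lattice L
  for L :: "('a, 'b) modal_FL_struct_scheme" (structure)

text \<open>The lattice operations are determined by the order, so preserving and reflecting the order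
  is all that has to be required of the lattice part of the signature.\<close>

definition modal_FL_iso ::
    "('a, 'c) modal_FL_struct_scheme \<Rightarrow> ('b, 'd) modal_FL_struct_scheme \<Rightarrow> ('a \<Rightarrow> 'b) set" where
  "modal_FL_iso L M = {h. bij_betw h (carrier L) (carrier M)
     \<and> (\<forall>a\<in>carrier L. \<forall>b\<in>carrier L.
          (a \<sqsubseteq>\<^bsub>L\<^esub> b \<longleftrightarrow> h a \<sqsubseteq>\<^bsub>M\<^esub> h b)
        \<and> h (a \<odot>\<^bsub>L\<^esub> b) = h a \<odot>\<^bsub>M\<^esub> h b
        \<and> h (a \<Rightarrow>\<^sub>l\<^bsub>L\<^esub> b) = (h a \<Rightarrow>\<^sub>l\<^bsub>M\<^esub> h b)
        \<and> h (a \<Rightarrow>\<^sub>r\<^bsub>L\<^esub> b) = (h a \<Rightarrow>\<^sub>r\<^bsub>M\<^esub> h b))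
     \<and> (\<forall>a\<in>carrier L. h (\<^bold>!\<^bsub>L\<^esub>a) = \<^bold>!\<^bsub>M\<^esub>(h a) \<and> h (\<^bold>?\<^bsub>L\<^esub>a) = \<^bold>?\<^bsub>M\<^esub>(h a))
     \<and> h \<^bold>1\<^bsub>L\<^esub> = \<^bold>1\<^bsub>M\<^esub> \<and> h \<^bold>0\<^bsub>L\<^esub> = \<^bold>0\<^bsub>M\<^esub>}"


section \<open>Modal FL-cover systems\<close>

text \<open>The monoid operation and identity \<open>\<otimes>\<close>, \<open>\<one>\<close> of these records are \<open>\<cdot>\<close> and \<open>\<epsilon>\<close>; with them,
  \<open>X <#> Y\<close>, \<open>x <# Y\<close> and \<open>X #> y\<close> are the complex products \<open>X \<cdot> Y\<close>, \<open>x \<cdot> Y\<close> and \<open>X \<cdot> y\<close>.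
  \<open>(x, y) \<in> ple S\<close> stands for \<open>x \<preceq> y\<close>, and \<open>(x, C) \<in> cov S\<close> for \<open>x \<lhd> C\<close>.\<close>

record 'a cover_struct = "'a monoid" +
  ple :: "('a \<times> 'a) set"
  cov :: "('a \<times> 'a set) set"

record 'a modal_cover_struct = "'a cover_struct" +
  falsum :: "'a set"
  idems :: "'a set"
  acc :: "('a \<times> 'a) set"

definition up :: "('a, 'b) cover_struct_scheme \<Rightarrow> 'a set \<Rightarrow> 'a set" where
  "up S X = {y. \<exists>x\<in>X. (x, y) \<in> ple S}"

definition jcl :: "('a, 'b) cover_struct_scheme \<Rightarrow> 'a set \<Rightarrow> 'a set" where
  "jcl S X = {x. \<exists>C. (x, C) \<in> cov S \<and> C \<subseteq> X}"

definition Props :: "('a, 'b) cover_struct_scheme \<Rightarrow> 'a set set" where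
  "Props S = {X. X \<subseteq> carrier S \<and> up S X = X \<and> jcl S X \<subseteq> X}"

definition dia :: "('a, 'b) modal_cover_struct_scheme \<Rightarrow> 'a set \<Rightarrow> 'a set" where
  "dia S X = {u. \<exists>v. (u, v) \<in> acc S \<and> v \<in> X}"

locale cover_system =
  fixes S :: "('a, 'b) cover_struct_scheme" (structure)
  assumes ple_preorder: "preorder_on (carrier S) (ple S)"
    and cov_subset: "cov S \<subseteq> carrier S \<times> Pow (carrier S)"
    and existence: "x \<in> carrier S \<Longrightarrow> \<exists>C. (x, C) \<in> cov S \<and> C \<subseteq> up S {x}"
    and transitivity: "\<lbrakk>(x, C) \<in> cov S; \<And>y. y \<in> C \<Longrightarrow> (y, D y) \<in> cov S\<rbrakk>
        \<Longrightarrow> (x, \<Union>y\<in>C. D y) \<in> cov S"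
    and refinement: "\<lbrakk>(x, y) \<in> ple S; (x, C) \<in> cov S\<rbrakk> \<Longrightarrow> \<exists>C'. C' \<subseteq> up S C \<and> (y, C') \<in> cov S"

locale residuated_cover_system = cover_system S + monoid S
  for S :: "('a, 'b) cover_struct_scheme" (structure) +
  assumes mult_mono: "\<lbrakk>(x, x') \<in> ple S; (y, y') \<in> ple S\<rbrakk> \<Longrightarrow> (x \<otimes> y, x' \<otimes> y') \<in> ple S"
    and cov_mult_right: "\<lbrakk>(x, C) \<in> cov S; y \<in> carrier S\<rbrakk> \<Longrightarrow> (x \<otimes> y, C #> y) \<in> cov S"
    and cov_mult_left: "\<lbrakk>(x, C) \<in> cov S; y \<in> carrier S\<rbrakk> \<Longrightarrow> (y \<otimes> x, y <# C) \<in> cov S"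
    and cov_one: "\<lbrakk>(x, C) \<in> cov S; C \<subseteq> up S {\<one>}\<rbrakk> \<Longrightarrow> (\<one>, x) \<in> ple S"

locale modal_FL_cover_system = residuated_cover_system S
  for S :: "('a, 'b) modal_cover_struct_scheme" (structure) +
  assumes falsum_prop: "falsum S \<in> Props S"
    and idems_subset: "idems S \<subseteq> up S {\<one>}"
    and acc_subset: "acc S \<subseteq> carrier S \<times> carrier S"
    and idems_mult: "\<lbrakk>x \<in> idems S; y \<in> idems S\<rbrakk> \<Longrightarrow> x \<otimes> y \<in> idems S"
    and idems_one: "\<one> \<in> idems S"
    and one_cov_idems: "(\<one>, idems S) \<in> cov S"
    and idems_idem: "x \<in> idems S \<Longrightarrow> x = x \<otimes> x"
    and idems_central: "\<lbrakk>x \<in> idems S; y \<in> carrier S\<rbrakk> \<Longrightarrow> x \<otimes> y = y \<otimes> x"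
    and acc_confluence: "\<lbrakk>(x, y) \<in> ple S; (x, z) \<in> acc S\<rbrakk> \<Longrightarrow> \<exists>w. (z, w) \<in> ple S \<and> (y, w) \<in> acc S"
    and acc_local: "\<lbrakk>X \<subseteq> carrier S; (x, C) \<in> cov S; C \<subseteq> dia S X\<rbrakk>
        \<Longrightarrow> \<exists>y D. (x, y) \<in> acc S \<and> (y, D) \<in> cov S \<and> D \<subseteq> X"
    and acc_mult_left: "\<lbrakk>x \<in> idems S; (y, z) \<in> acc S\<rbrakk> \<Longrightarrow> (x \<otimes> y, x \<otimes> z) \<in> acc S"
    and acc_mult_right: "\<lbrakk>x \<in> idems S; (y, z) \<in> acc S\<rbrakk> \<Longrightarrow> (y \<otimes> x, z \<otimes> x) \<in> acc S"
    and acc_refl: "refl_on (carrier S) (acc S)"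
    and acc_trans: "trans (acc S)"
    and acc_falsum: "\<lbrakk>(x, y) \<in> acc S; y \<in> falsum S\<rbrakk> \<Longrightarrow> x \<in> falsum S"
    and falsum_acc: "x \<in> falsum S \<Longrightarrow> \<exists>y. (x, y) \<in> acc S \<and> (y, {}) \<in> cov S"


section \<open>The algebra of propositions\<close>

definition Prop_algebra :: "('a, 'b) modal_cover_struct_scheme \<Rightarrow> 'a set modal_FL_struct" where
  "Prop_algebra S =
    \<lparr>carrier = Props S,
     eq = (=),
     le = (\<subseteq>),
     tensor = (\<lambda>X Y. jcl S (up S (X <#>\<^bsub>S\<^esub> Y))),
     tunit = up S {\<one>\<^bsub>S\<^esub>},
     limp = (\<lambda>X Y. {z \<in> carrier S. z <#\<^bsub>S\<^esub> X \<subseteq> Y}),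
     rimp = (\<lambda>X Y. {z \<in> carrier S. X #>\<^bsub>S\<^esub> z \<subseteq> Y}),
     fzero = falsum S,
     bang = (\<lambda>X. jcl S (up S (X \<inter> idems S))),
     quest = dia S\<rparr>"

definition strong :: "('a, 'b) modal_cover_struct_scheme \<Rightarrow> bool" where
  "strong S \<longleftrightarrow> (\<forall>X\<in>Props S. \<forall>Y\<in>Props S. X \<odot>\<^bsub>Prop_algebra S\<^esub> Y = up S (X <#>\<^bsub>S\<^esub> Y))"

end

theory Submission
  imports Defs
begin

text \<open>The elements of the algebra serve as points, ordered by the converse of \<open>\<sqsubseteq>\<close>, with
  \<open>x \<lhd> C\<close> iff \<open>x \<sqsubseteq> \<Squnion>C\<close>. A proposition is then a down-set of the algebra that is closed under all
  joins, i.e. a principal down-set, so that \<open>a \<mapsto> {x. x \<sqsubseteq> a}\<close> is the isomorphism. The fixed points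
  of \<open>!\<close> serve as \<open>I\<close>, and \<open>x R y\<close> iff \<open>x \<sqsubseteq> ?y\<close>.\<close>

section \<open>Propositions of a cover system\<close>

lemma (in cover_system) ple_refl: "x \<in> carrier S \<Longrightarrow> (x, x) \<in> ple S"
  using ple_preorder by (auto simp: preorder_on_def refl_on_def)

lemma (in cover_system) ple_carrier:
  "(x, y) \<in> ple S \<Longrightarrow> x \<in> carrier S" "(x, y) \<in> ple S \<Longrightarrow> y \<in> carrier S"
  using ple_preorder by (auto simp: preorder_on_def)

lemma jcl_mono: "X \<subseteq> Y \<Longrightarrow> jcl S X \<subseteq> jcl S Y"
  by (auto simp: jcl_def)

lemma up_mono: "X \<subseteq> Y \<Longrightarrow> up S X \<subseteq> up S Y"
  by (auto simp: up_def)

lemma (in cover_system) jcl_carrier: "jcl S X \<subseteq> carrier S"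
  using cov_subset by (auto simp: jcl_def)

lemma (in cover_system) up_extensive: "X \<subseteq> carrier S \<Longrightarrow> X \<subseteq> up S X"
  by (auto simp: up_def intro: ple_refl)

text \<open>Existence supplies a cover of \<open>x\<close> inside \<open>up S {x}\<close>, and an
  up-set containing \<open>x\<close> contains all of \<open>up S {x}\<close>.\<close>

lemma (in cover_system) jcl_extensive:
  assumes "X \<subseteq> carrier S" "up S X \<subseteq> X"
  shows "X \<subseteq> jcl S X"
proof
  fix x assume x: "x \<in> X"
  then obtain C where "(x, C) \<in> cov S" "C \<subseteq> up S {x}"
    using assms existence by blast
  moreover have "up S {x} \<subseteq> X"
    using x assms(2) up_mono[of "{x}" X] by blast
  ultimately show "x \<in> jcl S X"
    unfolding jcl_def by blast
qed

text \<open>One cover inside \<open>X\<close> is chosen for each member of \<open>C\<close>; by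
  transitivity their union again covers \<open>x\<close>.\<close>

lemma (in cover_system) jcl_jcl: "jcl S (jcl S X) \<subseteq> jcl S X"
proof
  fix x assume "x \<in> jcl S (jcl S X)"
  then obtain C where C: "(x, C) \<in> cov S" "\<And>y. y \<in> C \<Longrightarrow> \<exists>D. (y, D) \<in> cov S \<and> D \<subseteq> X"
    unfolding jcl_def by blast
  then obtain D where D: "\<And>y. y \<in> C \<Longrightarrow> (y, D y) \<in> cov S \<and> D y \<subseteq> X"
    by metis
  then have "(x, \<Union>y\<in>C. D y) \<in> cov S"
    using C(1) transitivity by blast
  with D show "x \<in> jcl S X"
    unfolding jcl_def by blast
qed

text \<open>Refinement carries a cover of \<open>x\<close> inside \<open>X\<close> to every
  \<open>y\<close> above \<open>x\<close>, so \<open>jcl\<close> of an up-set is an up-set; closure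
  is \<open>jcl_jcl\<close>.\<close>

lemma (in cover_system) jcl_Props:
  assumes "X \<subseteq> carrier S" "up S X \<subseteq> X"
  shows "jcl S X \<in> Props S"
proof -
  have "up S (jcl S X) \<subseteq> jcl S X"
  proof
    fix y assume "y \<in> up S (jcl S X)"
    then obtain x C where xy: "(x, y) \<in> ple S" and C: "(x, C) \<in> cov S" "C \<subseteq> X"
      unfolding up_def jcl_def by blast
    obtain C' where "C' \<subseteq> up S C" "(y, C') \<in> cov S"
      using refinement[OF xy C(1)] by blast
    moreover have "up S C \<subseteq> X"
      using C(2) assms(2) up_mono[of C X] by blast
    ultimately show "y \<in> jcl S X"
      unfolding jcl_def by blast
  qed
  then show ?thesis
    using jcl_jcl[of X] jcl_carrier[of X] up_extensive[of "jcl S X"] by (auto simp: Props_def)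
qed

section \<open>Meets and joins of propositions\<close>

text \<open>Intersecting with the carrier matters for the empty family, whose bare intersection is
  the whole type.\<close>

lemma (in cover_system) Inter_Props:
  assumes "A \<subseteq> Props S"
  shows "carrier S \<inter> \<Inter>A \<in> Props S"
proof -
  have "up S (carrier S \<inter> \<Inter>A) \<subseteq> carrier S \<inter> \<Inter>A"
    using assms ple_carrier(2) unfolding Props_def up_def by blast
  moreover have "jcl S (carrier S \<inter> \<Inter>A) \<subseteq> X" if "X \<in> A" for X
    using that assms jcl_mono[of "carrier S \<inter> \<Inter>A" X S] by (auto simp: Props_def)
  ultimately show ?thesis
    using up_extensive[of "carrier S \<inter> \<Inter>A"] jcl_carrier[of "carrier S \<inter> \<Inter>A"]
    by (auto simp: Props_def)
qed

lemma Prop_algebra_greatest: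
  assumes "cover_system S" "A \<subseteq> Props S"
  shows "greatest (Prop_algebra S) (carrier S \<inter> \<Inter>A) (Lower (Prop_algebra S) A)"
proof -
  interpret cover_system S by fact
  have "Y \<subseteq> carrier S \<inter> \<Inter>A" if "Y \<in> Props S" "\<forall>X\<in>A. Y \<subseteq> X" for Y
    using that by (auto simp: Props_def)
  \<comment> \<open>\<open>Lower\<close> compares only with those members of \<open>A\<close> that
    lie in the carrier.\<close>
  moreover have "A \<inter> Props S = A"
    using assms(2) by blast
  ultimately show ?thesis
    using Inter_Props[OF assms(2)]
    by (auto simp: greatest_def Lower_def Prop_algebra_def Int_absorb2 simp flip: Int_iff)
qed

text \<open>A union of propositions is an up-set, so its \<open>jcl\<close> is a proposition; any
  proposition including the whole union absorbs this \<open>jcl\<close> by monotonicity.\<close>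

lemma Prop_algebra_least:
  assumes "cover_system S" "A \<subseteq> Props S"
  shows "least (Prop_algebra S) (jcl S (\<Union>A)) (Upper (Prop_algebra S) A)"
proof -
  interpret cover_system S by fact
  have U: "\<Union>A \<subseteq> carrier S" "up S (\<Union>A) \<subseteq> \<Union>A"
    using assms(2) by (auto simp: Props_def up_def)
  have "X \<subseteq> jcl S (\<Union>A)" if "X \<in> A" for X
    using that jcl_extensive[OF U] by blast
  moreover have "jcl S (\<Union>A) \<subseteq> Y" if "Y \<in> Props S" "\<forall>X\<in>A. X \<subseteq> Y" for Y
  proof -
    have "jcl S (\<Union>A) \<subseteq> jcl S Y"
      using that(2) by (intro jcl_mono) blast
    then show ?thesis
      using that(1) by (auto simp: Props_def)
  qed
  ultimately show ?thesis
    using jcl_Props[OF U] assms(2)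
    by (simp add: least_def Upper_def Prop_algebra_def) blast
qed

lemma Prop_algebra_complete_lattice:
  assumes "cover_system S"
  shows "complete_lattice (Prop_algebra S)"
proof
  show "\<exists>s. least (Prop_algebra S) s (Upper (Prop_algebra S) A)"
    if "A \<subseteq> carrier (Prop_algebra S)" for A
    using that Prop_algebra_least[OF assms, of A] by (auto simp: Prop_algebra_def)
  show "\<exists>i. greatest (Prop_algebra S) i (Lower (Prop_algebra S) A)"
    if "A \<subseteq> carrier (Prop_algebra S)" for A
    using that Prop_algebra_greatest[OF assms, of A] by (auto simp: Prop_algebra_def)
qed (auto simp: Prop_algebra_def)

section \<open>Isomorphic images of modal FL-algebras\<close>

text \<open>This lets the modal axioms travel to the propositions instead of being checked there.
  \<open>M\<close> is assumed to be a bounded lattice because \<open>modal_FL_iso\<close> does not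
  constrain \<open>eq\<close>.\<close>

lemma modal_FL_algebra_iso_image:
  fixes L :: "('a, 'c) modal_FL_struct_scheme" (structure)
    and M :: "('b, 'd) modal_FL_struct_scheme"
  assumes "modal_FL_algebra L" "bounded_lattice M" "h \<in> modal_FL_iso L M"
  shows "modal_FL_algebra M"
proof -
  interpret L: modal_FL_algebra L by fact
  interpret M: bounded_lattice M by fact
  interpret T: monoid "\<lparr>carrier = carrier L, mult = tensor L, one = \<^bold>1\<rparr>"
    by (rule L.tensor_monoid)
  \<comment> \<open>The equations are oriented so that rewriting moves the operations of
    \<open>M\<close> into \<open>L\<close>, under a single \<open>h\<close>.\<close>
  have surj: "carrier M = h ` carrier L"
    and le: "\<And>a b. a \<in> carrier L \<Longrightarrow> b \<in> carrier L \<Longrightarrow> h a \<sqsubseteq>\<^bsub>M\<^esub> h b \<longleftrightarrow> a \<sqsubseteq> b"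
    and tens: "\<And>a b. a \<in> carrier L \<Longrightarrow> b \<in> carrier L \<Longrightarrow> h a \<odot>\<^bsub>M\<^esub> h b = h (a \<odot> b)"
    and li: "\<And>a b. a \<in> carrier L \<Longrightarrow> b \<in> carrier L \<Longrightarrow> (h a \<Rightarrow>\<^sub>l\<^bsub>M\<^esub> h b) = h (a \<Rightarrow>\<^sub>l b)"
    and ri: "\<And>a b. a \<in> carrier L \<Longrightarrow> b \<in> carrier L \<Longrightarrow> (h a \<Rightarrow>\<^sub>r\<^bsub>M\<^esub> h b) = h (a \<Rightarrow>\<^sub>r b)"
    and ba: "\<And>a. a \<in> carrier L \<Longrightarrow> \<^bold>!\<^bsub>M\<^esub>(h a) = h (\<^bold>!a)"
    and qu: "\<And>a. a \<in> carrier L \<Longrightarrow> \<^bold>?\<^bsub>M\<^esub>(h a) = h (\<^bold>?a)"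
    and one: "\<^bold>1\<^bsub>M\<^esub> = h \<^bold>1" and zero: "\<^bold>0\<^bsub>M\<^esub> = h \<^bold>0"
    using assms(3) by (auto simp: modal_FL_iso_def bij_betw_def)
  have tc: "a \<odot> b \<in> carrier L" if "a \<in> carrier L" "b \<in> carrier L" for a b
    using T.m_closed that by simp
  have oc: "\<^bold>1 \<in> carrier L"
    using T.one_closed by simp
  have ta: "(a \<odot> b) \<odot> c = a \<odot> (b \<odot> c)"
    if "a \<in> carrier L" "b \<in> carrier L" "c \<in> carrier L" for a b c
    using T.m_assoc that by simp
  have ol: "\<^bold>1 \<odot> a = a" "a \<odot> \<^bold>1 = a" if "a \<in> carrier L" for a
    using T.l_one T.r_one that by simp_all
  note closed = tc oc L.fzero_closed L.limp_closed L.rimp_closed L.bang_closed L.quest_closed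
  note hom = le tens li ri ba qu one zero closed
  \<comment> \<open>Axiom \<open>s4\<close> mentions meets, which \<open>modal_FL_iso\<close> leaves
    out. They are recovered from the order by pulling the meet in \<open>M\<close> back to some
    \<open>c\<close>.\<close>
  have meet: "h a \<sqinter>\<^bsub>M\<^esub> h b = h (a \<sqinter> b)" if ab: "a \<in> carrier L" "b \<in> carrier L" for a b
  proof -
    have hc: "h a \<in> carrier M" "h b \<in> carrier M" "h (a \<sqinter> b) \<in> carrier M"
      using ab surj by auto
    from hc obtain c where c: "c \<in> carrier L" "h a \<sqinter>\<^bsub>M\<^esub> h b = h c"
      using surj M.meet_closed[of "h a" "h b"] by auto
    have "c \<sqsubseteq> a \<sqinter> b"
      using M.meet_left[OF hc(1,2)] M.meet_right[OF hc(1,2)] ab c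
      by (auto simp: le intro: L.meet_le)
    moreover have "h (a \<sqinter> b) \<sqsubseteq>\<^bsub>M\<^esub> h a \<sqinter>\<^bsub>M\<^esub> h b"
      using ab hc by (intro M.meet_le) (auto simp: le intro: L.meet_left L.meet_right)
    ultimately show ?thesis
      using ab c hc by (intro M.le_antisym) (simp_all add: le surj)
  qed
  show ?thesis
  proof unfold_locales
    \<comment> \<open>\<open>c1l\<close> and \<open>c1r\<close> are treated apart because the
      residuation laws, rewrite rules for the other axioms, would turn them into inequalities
      between products; the commutation law is kept out of that rewriting too.\<close>
    show "\<^bold>!\<^bsub>M\<^esub>x \<odot>\<^bsub>M\<^esub> y = y \<odot>\<^bsub>M\<^esub> \<^bold>!\<^bsub>M\<^esub>x" if "x \<in> carrier M" "y \<in> carrier M" for x y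
      using that by (auto simp: surj hom L.s5)
    show "\<^bold>!\<^bsub>M\<^esub>(x \<Rightarrow>\<^sub>l\<^bsub>M\<^esub> y) \<sqsubseteq>\<^bsub>M\<^esub> (\<^bold>?\<^bsub>M\<^esub>x \<Rightarrow>\<^sub>l\<^bsub>M\<^esub> \<^bold>?\<^bsub>M\<^esub>y)"
      if "x \<in> carrier M" "y \<in> carrier M" for x y
      using that by (auto simp: surj hom L.c1l)
    show "\<^bold>!\<^bsub>M\<^esub>(x \<Rightarrow>\<^sub>r\<^bsub>M\<^esub> y) \<sqsubseteq>\<^bsub>M\<^esub> (\<^bold>?\<^bsub>M\<^esub>x \<Rightarrow>\<^sub>r\<^bsub>M\<^esub> \<^bold>?\<^bsub>M\<^esub>y)"
      if "x \<in> carrier M" "y \<in> carrier M" for x y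
      using that by (auto simp: surj hom L.c1r)
  \<comment> \<open>Unfolding \<open>surj\<close> presents each element of \<open>carrier M\<close>
    as an image under \<open>h\<close>, which reduces the goals to facts about
    \<open>L\<close>.\<close>
  qed (unfold surj partial_object.simps monoid.simps,
      ((elim imageE)?, simp add: hom imageI ta ol meet L.limp_residuation
        L.rimp_residuation[symmetric] L.tensor_mono
        L.s1 L.s2 L.s3 L.s4 L.c2 L.c3 L.c4 L.c5)+)
qed

section \<open>Order-complete modal FL-algebras\<close>

context modal_FL_algebra
begin

lemma tensor_closed [simp]: "a \<in> carrier L \<Longrightarrow> b \<in> carrier L \<Longrightarrow> a \<odot> b \<in> carrier L"
  using monoid.m_closed[OF tensor_monoid] by simp

lemma tunit_closed [simp]: "\<^bold>1 \<in> carrier L"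
  using monoid.one_closed[OF tensor_monoid] by simp

lemma tensor_assoc:
  "a \<in> carrier L \<Longrightarrow> b \<in> carrier L \<Longrightarrow> c \<in> carrier L \<Longrightarrow> (a \<odot> b) \<odot> c = a \<odot> (b \<odot> c)"
  using monoid.m_assoc[OF tensor_monoid] by simp

lemma tensor_tunit [simp]: "a \<in> carrier L \<Longrightarrow> \<^bold>1 \<odot> a = a" "a \<in> carrier L \<Longrightarrow> a \<odot> \<^bold>1 = a"
  using monoid.l_one[OF tensor_monoid] monoid.r_one[OF tensor_monoid] by simp_all

lemmas modal_FL_closed [simp] = limp_closed rimp_closed bang_closed quest_closed fzero_closed

lemma meet_absorb:
  assumes "a \<in> carrier L" "b \<in> carrier L" "a \<sqsubseteq> b"
  shows "a \<sqinter> b = a"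
  using assms le_iff_join by metis

text \<open>By \<open>s3\<close> and \<open>s4\<close>, \<open>!a\<close> equals \<open>bang\<close>
  of the meet of \<open>a\<close> with the unit, and \<open>s1\<close> puts this below the
  unit.\<close>

lemma bang_le_tunit:
  assumes "a \<in> carrier L"
  shows "\<^bold>!a \<sqsubseteq> \<^bold>1"
proof -
  have "\<^bold>!a = \<^bold>!(a \<sqinter> \<^bold>1)"
    using assms by (simp add: s4 s3)
  also have "\<dots> \<sqsubseteq> a \<sqinter> \<^bold>1"
    using assms by (simp add: s1)
  finally show ?thesis
    using assms meet_right[of a "\<^bold>1"] by (meson le_trans bang_closed meet_closed tunit_closed)
qed

text \<open>Here \<open>a\<close> is its own meet with \<open>b\<close>, so \<open>s4\<close>
  factors \<open>!a\<close> as the product of \<open>!a\<close> and \<open>!b\<close>, whose first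
  factor is below the unit.\<close>

lemma bang_mono:
  assumes "a \<in> carrier L" "b \<in> carrier L" "a \<sqsubseteq> b"
  shows "\<^bold>!a \<sqsubseteq> \<^bold>!b"
proof -
  have "\<^bold>!a = \<^bold>!a \<odot> \<^bold>!b"
    using assms s4[of a b] by (simp add: meet_absorb)
  also have "\<dots> \<sqsubseteq> \<^bold>1 \<odot> \<^bold>!b"
    using assms by (intro tensor_mono) (auto intro: bang_le_tunit)
  finally show ?thesis
    using assms by simp
qed

lemma bang_bang: "a \<in> carrier L \<Longrightarrow> \<^bold>!(\<^bold>!a) = \<^bold>!a"
  by (intro le_antisym) (auto intro: s1 s2)

lemma bang_idem: "a \<in> carrier L \<Longrightarrow> \<^bold>!a \<odot> \<^bold>!a = \<^bold>!a"
  using s4[of a a] by (simp add: meet_absorb)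

text \<open>The inequality becomes an implication above the unit; \<open>s3\<close> allows
  \<open>bang\<close> to be applied to it, and then \<open>c1l\<close> distributes
  \<open>quest\<close> over it.\<close>

lemma quest_mono:
  assumes "a \<in> carrier L" "b \<in> carrier L" "a \<sqsubseteq> b"
  shows "\<^bold>?a \<sqsubseteq> \<^bold>?b"
proof -
  have "\<^bold>1 \<sqsubseteq> (a \<Rightarrow>\<^sub>l b)"
    using assms by (simp add: limp_residuation)
  then have "\<^bold>1 \<sqsubseteq> \<^bold>!(a \<Rightarrow>\<^sub>l b)"
    using assms bang_mono[of "\<^bold>1"] by (simp add: s3)
  then have "\<^bold>1 \<sqsubseteq> (\<^bold>?a \<Rightarrow>\<^sub>l \<^bold>?b)"
    using assms c1l[of a b] by (meson le_trans limp_closed bang_closed quest_closed tunit_closed)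
  then show ?thesis
    using assms by (simp add: limp_residuation)
qed

text \<open>This will make \<open>acc\<close> stable under products with members of
  \<open>idems\<close>. By residuation \<open>x\<close> lies below the implication from
  \<open>z\<close> to the product; being a fixed point, \<open>x\<close> also lies below
  \<open>bang\<close> of it, and \<open>c1l\<close> applies.\<close>

lemma tensor_quest_le:
  assumes "x \<in> carrier L" "\<^bold>!x = x" "z \<in> carrier L"
  shows "x \<odot> \<^bold>?z \<sqsubseteq> \<^bold>?(x \<odot> z)"
proof -
  have "x \<sqsubseteq> (z \<Rightarrow>\<^sub>l x \<odot> z)"
    using assms by (simp add: limp_residuation)
  then have "x \<sqsubseteq> \<^bold>!(z \<Rightarrow>\<^sub>l x \<odot> z)"
    using assms bang_mono[of x] by simp
  then have "x \<sqsubseteq> (\<^bold>?z \<Rightarrow>\<^sub>l \<^bold>?(x \<odot> z))"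
    using assms c1l[of z "x \<odot> z"]
    by (meson le_trans limp_closed bang_closed quest_closed tensor_closed)
  then show ?thesis
    using assms by (simp add: limp_residuation)
qed

lemma quest_tensor_le:
  assumes "x \<in> carrier L" "\<^bold>!x = x" "z \<in> carrier L"
  shows "\<^bold>?z \<odot> x \<sqsubseteq> \<^bold>?(z \<odot> x)"
  using tensor_quest_le[OF assms] s5[of x z] s5[of x "\<^bold>?z"] assms by simp

end

section \<open>The canonical cover system\<close>

text \<open>As the order is reversed, \<open>up\<close> forms down-sets of \<open>L\<close>. In a
  complete lattice the empty set covers exactly the bottom element.\<close>

definition canonical_cover ::
    "('a, 'b) modal_FL_struct_scheme \<Rightarrow> 'a modal_cover_struct" where
  "canonical_cover L =
    \<lparr>carrier = carrier L, mult = tensor L, one = \<^bold>1\<^bsub>L\<^esub>,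
     ple = {(x, y). x \<in> carrier L \<and> y \<in> carrier L \<and> y \<sqsubseteq>\<^bsub>L\<^esub> x},
     cov = {(x, C). x \<in> carrier L \<and> C \<subseteq> carrier L \<and> x \<sqsubseteq>\<^bsub>L\<^esub> \<Squnion>\<^bsub>L\<^esub>C},
     falsum = {x \<in> carrier L. x \<sqsubseteq>\<^bsub>L\<^esub> \<^bold>0\<^bsub>L\<^esub>},
     idems = {x \<in> carrier L. \<^bold>!\<^bsub>L\<^esub>x = x},
     acc = {(x, y). x \<in> carrier L \<and> y \<in> carrier L \<and> x \<sqsubseteq>\<^bsub>L\<^esub> \<^bold>?\<^bsub>L\<^esub>y}\<rparr>"

lemma canonical_cover_sel [simp]:
  "carrier (canonical_cover L) = carrier L"
  "mult (canonical_cover L) = tensor L"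
  "one (canonical_cover L) = \<^bold>1\<^bsub>L\<^esub>"
  "(x, y) \<in> ple (canonical_cover L) \<longleftrightarrow> x \<in> carrier L \<and> y \<in> carrier L \<and> y \<sqsubseteq>\<^bsub>L\<^esub> x"
  "(x, C) \<in> cov (canonical_cover L) \<longleftrightarrow> x \<in> carrier L \<and> C \<subseteq> carrier L \<and> x \<sqsubseteq>\<^bsub>L\<^esub> \<Squnion>\<^bsub>L\<^esub>C"
  "falsum (canonical_cover L) = {x \<in> carrier L. x \<sqsubseteq>\<^bsub>L\<^esub> \<^bold>0\<^bsub>L\<^esub>}"
  "idems (canonical_cover L) = {x \<in> carrier L. \<^bold>!\<^bsub>L\<^esub>x = x}"
  "(x, y) \<in> acc (canonical_cover L) \<longleftrightarrow> x \<in> carrier L \<and> y \<in> carrier L \<and> x \<sqsubseteq>\<^bsub>L\<^esub> \<^bold>?\<^bsub>L\<^esub>y"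
  by (simp_all add: canonical_cover_def)

definition downset :: "('a, 'b) gorder_scheme \<Rightarrow> 'a \<Rightarrow> 'a set" where
  "downset L a = {x \<in> carrier L. x \<sqsubseteq>\<^bsub>L\<^esub> a}"

context order_complete_modal_FL_algebra
begin

abbreviation "S \<equiv> canonical_cover L"

lemma sup_le_iff:
  assumes "C \<subseteq> carrier L" "z \<in> carrier L"
  shows "\<Squnion>C \<sqsubseteq> z \<longleftrightarrow> (\<forall>x\<in>C. x \<sqsubseteq> z)"
  using assms sup_least[of C z] sup_upper[of C] by (meson le_trans subsetD sup_closed)

text \<open>Right multiplication by \<open>y\<close> is a lower adjoint by residuation, hence
  preserves joins; this is the half that multiplying covers requires.\<close>

lemma sup_tensor_le:
  assumes "C \<subseteq> carrier L" "y \<in> carrier L"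
  shows "\<Squnion>C \<odot> y \<sqsubseteq> \<Squnion>((\<lambda>c. c \<odot> y) ` C)"
proof -
  have D: "(\<lambda>c. c \<odot> y) ` C \<subseteq> carrier L"
    using assms by auto
  have "\<Squnion>C \<sqsubseteq> (y \<Rightarrow>\<^sub>l \<Squnion>((\<lambda>c. c \<odot> y) ` C))"
    using assms D sup_upper[OF D] by (subst sup_le_iff) (auto simp: limp_residuation subset_iff)
  then show ?thesis
    using assms D by (simp add: limp_residuation)
qed

lemma tensor_sup_le:
  assumes "C \<subseteq> carrier L" "y \<in> carrier L"
  shows "y \<odot> \<Squnion>C \<sqsubseteq> \<Squnion>((\<lambda>c. y \<odot> c) ` C)"
proof -
  have D: "(\<lambda>c. y \<odot> c) ` C \<subseteq> carrier L"
    using assms by auto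
  have "\<Squnion>C \<sqsubseteq> (y \<Rightarrow>\<^sub>r \<Squnion>((\<lambda>c. y \<odot> c) ` C))"
    using assms D sup_upper[OF D]
    by (subst sup_le_iff) (auto simp: rimp_residuation[symmetric] subset_iff)
  then show ?thesis
    using assms D by (simp add: rimp_residuation)
qed

section \<open>Propositions as principal down-sets\<close>

lemma up_singleton: "x \<in> carrier L \<Longrightarrow> up S {x} = downset L x"
  by (auto simp: up_def downset_def)

text \<open>A join of elements below \<open>a\<close> stays below \<open>a\<close>; conversely each
  \<open>x\<close> is covered by \<open>{x}\<close>.\<close>

lemma jcl_downset: "a \<in> carrier L \<Longrightarrow> jcl S (downset L a) = downset L a"
proof (intro equalityI subsetI)
  fix x assume a: "a \<in> carrier L" and "x \<in> jcl S (downset L a)"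
  then obtain C where "(x, C) \<in> cov S" and D: "C \<subseteq> downset L a"
    unfolding jcl_def by blast
  then have C: "x \<in> carrier L" "C \<subseteq> carrier L" "x \<sqsubseteq> \<Squnion>C"
    by simp_all
  have "\<Squnion>C \<sqsubseteq> a"
    using a C(2) D by (subst sup_le_iff) (auto simp: downset_def)
  then have "x \<sqsubseteq> a"
    using C a by (meson le_trans sup_closed)
  then show "x \<in> downset L a"
    using C(1) by (simp add: downset_def)
next
  fix x assume a: "a \<in> carrier L" and x: "x \<in> downset L a"
  then have "(x, {x}) \<in> cov S" "{x} \<subseteq> downset L a"
    by (simp_all add: downset_def)
  then show "x \<in> jcl S (downset L a)"
    unfolding jcl_def by blast
qed

lemma up_downset: "a \<in> carrier L \<Longrightarrow> up S (downset L a) = downset L a"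
  by (auto simp: up_def downset_def intro: le_trans)

lemma downset_Props: "a \<in> carrier L \<Longrightarrow> downset L a \<in> Props S"
  by (simp add: Props_def jcl_downset up_downset) (simp add: downset_def)

text \<open>Every \<open>X\<close> covers its own join, so a proposition contains its join and,
  being an up-set of the reversed order, everything below it.\<close>

lemma Props_canonical: "Props S = downset L ` carrier L"
proof (intro equalityI subsetI)
  fix X assume "X \<in> Props S"
  then have X: "X \<subseteq> carrier L" "up S X \<subseteq> X" "jcl S X \<subseteq> X"
    by (auto simp: Props_def)
  have "\<Squnion>X \<in> jcl S X"
    using X(1) unfolding jcl_def by (intro CollectI exI[of _ X]) simp
  then have "\<Squnion>X \<in> X"
    using X(3) by blast
  then have "downset L (\<Squnion>X) \<subseteq> X"
    using X(1,2) up_mono[of "{\<Squnion>X}" X S] up_singleton[of "\<Squnion>X"] by simp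
  moreover have "X \<subseteq> downset L (\<Squnion>X)"
    using X(1) sup_upper[OF X(1)] unfolding downset_def by blast
  ultimately have "X = downset L (\<Squnion>X)"
    by (rule equalityI[rotated])
  then show "X \<in> downset L ` carrier L"
    by (rule image_eqI) (use X(1) in simp)
next
  fix X assume "X \<in> downset L ` carrier L"
  then show "X \<in> Props S"
    using downset_Props by blast
qed

lemma downset_subset_iff:
  "a \<in> carrier L \<Longrightarrow> b \<in> carrier L \<Longrightarrow> downset L a \<subseteq> downset L b \<longleftrightarrow> a \<sqsubseteq> b"
  unfolding downset_def by (blast intro: le_trans)

section \<open>The operations on principal down-sets\<close>

text \<open>The product of the two greatest elements lies in the complex product, so everything
  below it is reached before \<open>jcl\<close> is applied. This is the source of strength.\<close>

lemma up_set_mult_downset: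
  assumes "a \<in> carrier L" "b \<in> carrier L"
  shows "up S (downset L a <#>\<^bsub>S\<^esub> downset L b) = downset L (a \<odot> b)"
proof (intro equalityI subsetI)
  fix z assume "z \<in> up S (downset L a <#>\<^bsub>S\<^esub> downset L b)"
  then obtain x y where xy: "x \<in> carrier L" "x \<sqsubseteq> a" "y \<in> carrier L" "y \<sqsubseteq> b"
    and z: "z \<in> carrier L" "z \<sqsubseteq> x \<odot> y"
    by (auto simp: up_def set_mult_def downset_def)
  then have "x \<odot> y \<sqsubseteq> a \<odot> b"
    using assms by (intro tensor_mono)
  then have "z \<sqsubseteq> a \<odot> b"
    using z xy assms by (meson le_trans tensor_closed)
  then show "z \<in> downset L (a \<odot> b)"
    using z by (simp add: downset_def)
next
  fix z assume "z \<in> downset L (a \<odot> b)"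
  then have "(a \<odot> b, z) \<in> ple S"
    using assms by (simp add: downset_def)
  moreover have "a \<odot> b \<in> downset L a <#>\<^bsub>S\<^esub> downset L b"
    using assms unfolding set_mult_def by (intro UN_I[of a] UN_I[of b]) (simp_all add: downset_def)
  ultimately show "z \<in> up S (downset L a <#>\<^bsub>S\<^esub> downset L b)"
    unfolding up_def by blast
qed

text \<open>The product of \<open>z\<close> and \<open>a\<close> is the greatest element of the
  coset, so the inclusion only says that it is below \<open>b\<close>; residuation does the rest.
  \<open>rimp_downset\<close> is the mirror image.\<close>

lemma limp_downset:
  assumes "a \<in> carrier L" "b \<in> carrier L"
  shows "{z \<in> carrier S. z <#\<^bsub>S\<^esub> downset L a \<subseteq> downset L b} = downset L (a \<Rightarrow>\<^sub>l b)"
proof (intro equalityI subsetI)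
  fix z assume "z \<in> {z \<in> carrier S. z <#\<^bsub>S\<^esub> downset L a \<subseteq> downset L b}"
  then have "z \<in> carrier L" "z <#\<^bsub>S\<^esub> downset L a \<subseteq> downset L b"
    by simp_all
  moreover have "z \<odot> a \<in> z <#\<^bsub>S\<^esub> downset L a"
    using assms unfolding l_coset_def by (intro UN_I[of a]) (simp_all add: downset_def)
  ultimately have "z \<in> carrier L" "z \<odot> a \<sqsubseteq> b"
    unfolding downset_def by blast+
  then show "z \<in> downset L (a \<Rightarrow>\<^sub>l b)"
    using assms by (simp add: downset_def limp_residuation)
next
  fix z assume "z \<in> downset L (a \<Rightarrow>\<^sub>l b)"
  then have z: "z \<in> carrier L" "z \<odot> a \<sqsubseteq> b"
    using assms by (auto simp: downset_def limp_residuation)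
  have "z \<odot> x \<sqsubseteq> b" if "x \<in> carrier L" "x \<sqsubseteq> a" for x
    using that z assms tensor_mono[of z z x a] by (meson le_refl le_trans tensor_closed)
  then show "z \<in> {z \<in> carrier S. z <#\<^bsub>S\<^esub> downset L a \<subseteq> downset L b}"
    using z by (auto simp: l_coset_def downset_def)
qed

lemma rimp_downset:
  assumes "a \<in> carrier L" "b \<in> carrier L"
  shows "{z \<in> carrier S. downset L a #>\<^bsub>S\<^esub> z \<subseteq> downset L b} = downset L (a \<Rightarrow>\<^sub>r b)"
proof (intro equalityI subsetI)
  fix z assume "z \<in> {z \<in> carrier S. downset L a #>\<^bsub>S\<^esub> z \<subseteq> downset L b}"
  then have "z \<in> carrier L" "downset L a #>\<^bsub>S\<^esub> z \<subseteq> downset L b"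
    by simp_all
  moreover have "a \<odot> z \<in> downset L a #>\<^bsub>S\<^esub> z"
    using assms unfolding r_coset_def by (intro UN_I[of a]) (simp_all add: downset_def)
  ultimately have "z \<in> carrier L" "a \<odot> z \<sqsubseteq> b"
    unfolding downset_def by blast+
  then show "z \<in> downset L (a \<Rightarrow>\<^sub>r b)"
    using assms by (simp add: downset_def rimp_residuation)
next
  fix z assume "z \<in> downset L (a \<Rightarrow>\<^sub>r b)"
  then have z: "z \<in> carrier L" "a \<odot> z \<sqsubseteq> b"
    using assms by (auto simp: downset_def rimp_residuation)
  have "x \<odot> z \<sqsubseteq> b" if "x \<in> carrier L" "x \<sqsubseteq> a" for x
    using that z assms tensor_mono[of x a z z] by (meson le_refl le_trans tensor_closed)
  then show "z \<in> {z \<in> carrier S. downset L a #>\<^bsub>S\<^esub> z \<subseteq> downset L b}"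
    using z by (auto simp: r_coset_def downset_def)
qed

text \<open>\<open>!a\<close> is the greatest fixed point of \<open>bang\<close> below
  \<open>a\<close>: it is one by \<open>s1\<close> and \<open>s2\<close>, and
  \<open>bang_mono\<close> bounds the others.\<close>

lemma bang_downset:
  assumes "a \<in> carrier L"
  shows "jcl S (up S (downset L a \<inter> idems S)) = downset L (\<^bold>!a)"
proof -
  have "up S (downset L a \<inter> idems S) = downset L (\<^bold>!a)"
  proof (intro equalityI subsetI)
    fix y assume "y \<in> up S (downset L a \<inter> idems S)"
    then obtain x where x: "x \<in> carrier L" "x \<sqsubseteq> a" "\<^bold>!x = x" and y: "y \<in> carrier L" "y \<sqsubseteq> x"
      by (auto simp: up_def downset_def)
    have "x \<sqsubseteq> \<^bold>!a"
      using bang_mono[of x a] x assms by simp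
    then show "y \<in> downset L (\<^bold>!a)"
      using x y assms by (auto simp: downset_def intro: le_trans[of y x])
  next
    fix y assume "y \<in> downset L (\<^bold>!a)"
    then have "(\<^bold>!a, y) \<in> ple S"
      using assms by (simp add: downset_def)
    moreover have "\<^bold>!a \<in> downset L a \<inter> idems S"
      using assms by (simp add: downset_def bang_bang s1)
    ultimately show "y \<in> up S (downset L a \<inter> idems S)"
      unfolding up_def by blast
  qed
  then show ?thesis
    using assms by (simp add: jcl_downset)
qed

text \<open>Monotonicity of \<open>quest\<close> makes \<open>a\<close> itself the best successor to
  choose in the down-set.\<close>

lemma quest_downset:
  assumes "a \<in> carrier L"
  shows "dia S (downset L a) = downset L (\<^bold>?a)"
proof (intro equalityI subsetI)
  fix x assume "x \<in> dia S (downset L a)"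
  then obtain y where y: "x \<in> carrier L" "y \<in> carrier L" "x \<sqsubseteq> \<^bold>?y" "y \<sqsubseteq> a"
    by (auto simp: dia_def downset_def)
  then have "\<^bold>?y \<sqsubseteq> \<^bold>?a"
    using assms by (intro quest_mono)
  then show "x \<in> downset L (\<^bold>?a)"
    using y assms by (auto simp: downset_def intro: le_trans[of x "\<^bold>?y"])
qed (use assms in \<open>auto simp: dia_def downset_def\<close>)

section \<open>The axioms for the canonical cover system\<close>

lemma canonical_cover_system: "cover_system S"
proof
  show "preorder_on (carrier S) (ple S)"
    unfolding preorder_on_def refl_on_def trans_def by (auto intro: le_trans)
  show "cov S \<subseteq> carrier S \<times> Pow (carrier S)"
    by auto
  show "\<exists>C. (x, C) \<in> cov S \<and> C \<subseteq> up S {x}" if "x \<in> carrier S" for x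
    using that by (intro exI[of _ "{x}"]) (auto simp: up_def)
  show "(x, \<Union>y\<in>C. D y) \<in> cov S"
    if xC: "(x, C) \<in> cov S" and D: "\<And>y. y \<in> C \<Longrightarrow> (y, D y) \<in> cov S" for x C D
  proof -
    have C: "x \<in> carrier L" "C \<subseteq> carrier L" "x \<sqsubseteq> \<Squnion>C"
      using xC by auto
    have U: "(\<Union>y\<in>C. D y) \<subseteq> carrier L"
      using D by fastforce
    \<comment> \<open>Each \<open>y\<close> lies below the join of its own cover, which is part of
      the union.\<close>
    have "y \<sqsubseteq> \<Squnion>(\<Union>y\<in>C. D y)" if y: "y \<in> C" for y
    proof -
      have Dy: "y \<in> carrier L" "D y \<subseteq> carrier L" "y \<sqsubseteq> \<Squnion>(D y)"
        using D[OF y] by auto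
      have "\<Squnion>(D y) \<sqsubseteq> \<Squnion>(\<Union>y\<in>C. D y)"
        using y by (intro sup_least[OF Dy(2) sup_closed[OF U]] sup_upper[OF U]) blast
      then show ?thesis
        using Dy U by (meson le_trans sup_closed)
    qed
    then have "\<Squnion>C \<sqsubseteq> \<Squnion>(\<Union>y\<in>C. D y)"
      by (intro sup_least[OF C(2) sup_closed[OF U]])
    then have "x \<sqsubseteq> \<Squnion>(\<Union>y\<in>C. D y)"
      using C U by (meson le_trans sup_closed)
    then show ?thesis
      using C U by simp
  qed
  show "\<exists>C'. C' \<subseteq> up S C \<and> (y, C') \<in> cov S" if "(x, y) \<in> ple S" "(x, C) \<in> cov S" for x y C
  \<comment> \<open>The witness is \<open>C\<close> itself: going up in \<open>ple\<close> is going
    down in \<open>L\<close>, so \<open>y\<close> stays below the join of \<open>C\<close>.\<close>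
  proof (intro exI conjI)
    show "C \<subseteq> up S C"
    proof
      fix c assume c: "c \<in> C"
      then have "(c, c) \<in> ple S"
        using that(2) by auto
      with c show "c \<in> up S C"
        unfolding up_def by blast
    qed
    show "(y, C) \<in> cov S"
      using that by (auto intro: le_trans[of y x])
  qed
qed

lemma canonical_residuated_cover_system: "residuated_cover_system S"
proof -
  interpret cover_system S by (rule canonical_cover_system)
  show ?thesis
  proof
    show "(x \<otimes>\<^bsub>S\<^esub> y, C #>\<^bsub>S\<^esub> y) \<in> cov S" if "(x, C) \<in> cov S" "y \<in> carrier S" for x C y
    proof -
      have x: "x \<in> carrier L" "C \<subseteq> carrier L" "x \<sqsubseteq> \<Squnion>C" "y \<in> carrier L"
        using that by auto
      have D: "(\<lambda>c. c \<odot> y) ` C \<subseteq> carrier L"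
        using x by auto
      have "x \<odot> y \<sqsubseteq> \<Squnion>C \<odot> y"
        using x by (intro tensor_mono) auto
      then have "x \<odot> y \<sqsubseteq> \<Squnion>((\<lambda>c. c \<odot> y) ` C)"
        using x D sup_tensor_le[of C y] by (meson le_trans sup_closed tensor_closed)
      moreover have "C #>\<^bsub>S\<^esub> y = (\<lambda>c. c \<odot> y) ` C"
        by (auto simp: r_coset_def)
      ultimately show ?thesis
        using x D by simp
    qed
    show "(y \<otimes>\<^bsub>S\<^esub> x, y <#\<^bsub>S\<^esub> C) \<in> cov S" if "(x, C) \<in> cov S" "y \<in> carrier S" for x C y
    proof -
      have x: "x \<in> carrier L" "C \<subseteq> carrier L" "x \<sqsubseteq> \<Squnion>C" "y \<in> carrier L"
        using that by auto
      have D: "(\<lambda>c. y \<odot> c) ` C \<subseteq> carrier L"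
        using x by auto
      have "y \<odot> x \<sqsubseteq> y \<odot> \<Squnion>C"
        using x by (intro tensor_mono) auto
      then have "y \<odot> x \<sqsubseteq> \<Squnion>((\<lambda>c. y \<odot> c) ` C)"
        using x D tensor_sup_le[of C y] by (meson le_trans sup_closed tensor_closed)
      moreover have "y <#\<^bsub>S\<^esub> C = (\<lambda>c. y \<odot> c) ` C"
        by (auto simp: l_coset_def)
      ultimately show ?thesis
        using x D by simp
    qed
    \<comment> \<open>Since \<open>up\<close> of the unit is its principal down-set,
      \<open>cov_one\<close> amounts to closure of that set under \<open>jcl\<close>.\<close>
    show "(\<one>\<^bsub>S\<^esub>, x) \<in> ple S" if "(x, C) \<in> cov S" "C \<subseteq> up S {\<one>\<^bsub>S\<^esub>}" for x C
    proof -
      have "x \<in> jcl S (downset L \<^bold>1)"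
        using that up_singleton[of "\<^bold>1"] unfolding jcl_def by auto
      then have "x \<in> downset L \<^bold>1"
        by (simp add: jcl_downset)
      then show ?thesis
        by (simp add: downset_def)
    qed
  qed (auto simp: tensor_assoc intro: tensor_mono)
qed

lemma canonical_modal_FL_cover_system: "modal_FL_cover_system S"
proof -
  interpret residuated_cover_system S by (rule canonical_residuated_cover_system)
  show ?thesis
  proof
    show "falsum S \<in> Props S"
      using downset_Props[of "\<^bold>0"] by (simp add: downset_def)
    show "idems S \<subseteq> up S {\<one>\<^bsub>S\<^esub>}"
      using bang_le_tunit by (fastforce simp: up_def)
    show "acc S \<subseteq> carrier S \<times> carrier S"
      by auto
    show "x \<otimes>\<^bsub>S\<^esub> y \<in> idems S" if "x \<in> idems S" "y \<in> idems S" for x y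
    proof -
      have x: "x \<in> carrier L" "\<^bold>!x = x" "y \<in> carrier L" "\<^bold>!y = y"
        using that by auto
      \<comment> \<open>By \<open>s4\<close> a product of two fixed points is a value of
        \<open>bang\<close>, hence again a fixed point.\<close>
      then have "x \<odot> y = \<^bold>!(x \<sqinter> y)"
        by (simp add: s4)
      then show ?thesis
        using x by (simp add: bang_bang)
    qed
    show "\<one>\<^bsub>S\<^esub> \<in> idems S"
      by (simp add: s3)
    show "(\<one>\<^bsub>S\<^esub>, idems S) \<in> cov S"
      using sup_upper[of "{x \<in> carrier L. \<^bold>!x = x}" "\<^bold>1"] by (simp add: s3)
    show "x = x \<otimes>\<^bsub>S\<^esub> x" if "x \<in> idems S" for x
      using that bang_idem[of x] by simp
    show "x \<otimes>\<^bsub>S\<^esub> y = y \<otimes>\<^bsub>S\<^esub> x" if "x \<in> idems S" "y \<in> carrier S" for x y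
      using that s5[of x y] by simp
    show "\<exists>w. (z, w) \<in> ple S \<and> (y, w) \<in> acc S" if "(x, y) \<in> ple S" "(x, z) \<in> acc S" for x y z
      using that by (intro exI[of _ z]) (auto intro: le_trans[of y x])
    \<comment> \<open>The point to reach is the join of \<open>X\<close>, covered by
      \<open>X\<close> itself. It bounds each \<open>v\<close> in \<open>X\<close>, so its
      \<open>quest\<close> bounds all of \<open>C\<close> and therefore \<open>x\<close>.\<close>
    show "\<exists>y D. (x, y) \<in> acc S \<and> (y, D) \<in> cov S \<and> D \<subseteq> X"
      if "X \<subseteq> carrier S" "(x, C) \<in> cov S" "C \<subseteq> dia S X" for X x C
    proof -
      have X: "X \<subseteq> carrier L" and x: "x \<in> carrier L" "C \<subseteq> carrier L" "x \<sqsubseteq> \<Squnion>C"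
        using that by auto
      have "u \<sqsubseteq> \<^bold>?(\<Squnion>X)" if "u \<in> C" for u
      proof -
        have "u \<in> dia S X"
          using \<open>C \<subseteq> dia S X\<close> that by blast
        then obtain v where v: "u \<in> carrier L" "v \<in> X" "u \<sqsubseteq> \<^bold>?v"
          by (auto simp: dia_def)
        have "\<^bold>?v \<sqsubseteq> \<^bold>?(\<Squnion>X)"
          using X v by (intro quest_mono sup_upper) auto
        then show ?thesis
          using X v by (meson le_trans quest_closed subsetD sup_closed)
      qed
      then have "\<Squnion>C \<sqsubseteq> \<^bold>?(\<Squnion>X)"
        using X x by (subst sup_le_iff) auto
      then have "x \<sqsubseteq> \<^bold>?(\<Squnion>X)"
        using X x by (meson le_trans quest_closed sup_closed)
      then show ?thesis
        using X x by (intro exI[of _ "\<Squnion>X"] exI[of _ X]) auto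
    qed
    show "(x \<otimes>\<^bsub>S\<^esub> y, x \<otimes>\<^bsub>S\<^esub> z) \<in> acc S" if "x \<in> idems S" "(y, z) \<in> acc S" for x y z
    proof -
      have x: "x \<in> carrier L" "\<^bold>!x = x" "y \<in> carrier L" "z \<in> carrier L" "y \<sqsubseteq> \<^bold>?z"
        using that by auto
      then have "x \<odot> y \<sqsubseteq> x \<odot> \<^bold>?z"
        by (intro tensor_mono) auto
      then show ?thesis
        using x tensor_quest_le[of x z] by (auto intro: le_trans[of "x \<odot> y" "x \<odot> \<^bold>?z"])
    qed
    show "(y \<otimes>\<^bsub>S\<^esub> x, z \<otimes>\<^bsub>S\<^esub> x) \<in> acc S" if "x \<in> idems S" "(y, z) \<in> acc S" for x y z
    proof -
      have x: "x \<in> carrier L" "\<^bold>!x = x" "y \<in> carrier L" "z \<in> carrier L" "y \<sqsubseteq> \<^bold>?z"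
        using that by auto
      then have "y \<odot> x \<sqsubseteq> \<^bold>?z \<odot> x"
        by (intro tensor_mono) auto
      then show ?thesis
        using x quest_tensor_le[of x z] by (auto intro: le_trans[of "y \<odot> x" "\<^bold>?z \<odot> x"])
    qed
    \<comment> \<open>Reflexivity is \<open>c2\<close>; transitivity below combines
      \<open>quest_mono\<close> with \<open>c3\<close>.\<close>
    show "refl_on (carrier S) (acc S)"
      by (auto simp: refl_on_def c2)
    show "trans (acc S)"
    proof (rule transI)
      fix x y z assume "(x, y) \<in> acc S" "(y, z) \<in> acc S"
      then have xyz: "x \<in> carrier L" "y \<in> carrier L" "z \<in> carrier L" "x \<sqsubseteq> \<^bold>?y" "y \<sqsubseteq> \<^bold>?z"
        by auto
      then have "\<^bold>?y \<sqsubseteq> \<^bold>?(\<^bold>?z)"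
        by (intro quest_mono) auto
      then show "(x, z) \<in> acc S"
        using xyz c3[of z] by simp (meson le_trans quest_closed)
    qed
    show "x \<in> falsum S" if "(x, y) \<in> acc S" "y \<in> falsum S" for x y
    proof -
      have xy: "x \<in> carrier L" "y \<in> carrier L" "x \<sqsubseteq> \<^bold>?y" "y \<sqsubseteq> \<^bold>0"
        using that by auto
      then have "\<^bold>?y \<sqsubseteq> \<^bold>?\<^bold>0"
        by (intro quest_mono) auto
      then show ?thesis
        using xy c4 by simp (meson le_trans quest_closed fzero_closed)
    qed
    \<comment> \<open>The witness is the join of the empty set, which the empty set covers;
      \<open>c5\<close> puts the zero, and so \<open>x\<close>, below its
      \<open>quest\<close>.\<close>
    show "\<exists>y. (x, y) \<in> acc S \<and> (y, {}) \<in> cov S" if "x \<in> falsum S" for x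
      using that c5[of "\<Squnion>{}"] by (intro exI[of _ "\<Squnion>{}"]) (auto intro: le_trans[of x "\<^bold>0"])
  qed
qed

section \<open>Strength and the isomorphism\<close>

lemma canonical_strong: "strong S"
  unfolding strong_def Props_canonical
  by (auto simp: Prop_algebra_def up_set_mult_downset jcl_downset)

lemma downset_iso: "downset L \<in> modal_FL_iso L (Prop_algebra S)"
proof -
  have "inj_on (downset L) (carrier L)"
    using downset_subset_iff by (intro inj_onI) (metis le_antisym order_refl)
  then have "bij_betw (downset L) (carrier L) (carrier (Prop_algebra S))"
    by (simp add: bij_betw_def Prop_algebra_def Props_canonical)
  moreover have "downset L \<^bold>0 = falsum S"
    by (simp add: downset_def)
  ultimately show ?thesis
    using up_singleton[of "\<^bold>1"]
    \<comment> \<open>Simplification rewrites selectors such as \<open>carrier S\<close> in the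
      goal; \<open>[simplified]\<close> brings the rules into the same form.\<close>
    by (simp add: modal_FL_iso_def Prop_algebra_def downset_subset_iff up_set_mult_downset
        jcl_downset limp_downset[simplified] rimp_downset[simplified] bang_downset[simplified]
        quest_downset)
qed

end

theorem theorem3:
  fixes L :: "('a, 'b) modal_FL_struct_scheme"
  assumes "order_complete_modal_FL_algebra L"
  shows "\<exists>S :: 'a modal_cover_struct.
    modal_FL_cover_system S \<and> strong S
    \<and> modal_FL_algebra (Prop_algebra S)
    \<and> (\<forall>A \<subseteq> Props S.
          greatest (Prop_algebra S) (carrier S \<inter> \<Inter>A) (Lower (Prop_algebra S) A)
        \<and> least (Prop_algebra S) (jcl S (\<Union>A)) (Upper (Prop_algebra S) A))
    \<and> (\<exists>h. h \<in> modal_FL_iso L (Prop_algebra S))"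
proof -
  interpret order_complete_modal_FL_algebra L by fact
  let ?S = "canonical_cover L"
  interpret P: complete_lattice "Prop_algebra ?S"
    by (rule Prop_algebra_complete_lattice[OF canonical_cover_system])
  \<comment> \<open>The lattice structure comes from the cover system alone; the other axioms are
    carried over from \<open>L\<close> along \<open>downset L\<close>.\<close>
  have "modal_FL_algebra (Prop_algebra ?S)"
    using modal_FL_algebra_iso_image[OF _ _ downset_iso] modal_FL_algebra_axioms
      bounded_lattice.intro[OF P.lattice_axioms P.weak.weak_partial_order_bottom_axioms
        P.weak.weak_partial_order_top_axioms]
    by blast
  then show ?thesis
    using canonical_modal_FL_cover_system canonical_strong downset_iso
      Prop_algebra_greatest[OF canonical_cover_system]
      Prop_algebra_least[OF canonical_cover_system]
    by blast
qed

end
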